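(* Let $r>0$, let $P_0\in\mathcal{M}(\mathbb{R}^{N_x})$ be absolutely continuous with respect to the Lebesgue measure on $\mathbb{R}^{N_x}$, and let $\mathcal{P}:=\{P\in\mathcal{M}(\mathbb{R}^{N_x}) \mid W_2(P,P_0)\le r\}$. Let $C\in\mathbb{S}^{N_x}$ satisfy $\lambda_{\max}(C)\neq 0$. Then the optimal value of the worst-case expectation problem $$\sup_{P\in\mathcal{P}}\mathbb{E}_P[w^\top C w]$$ is finite and equal to the optimal value of the following convex program: $$\inf_{\gamma\ge 0}\left\{\gamma\,(r^2-\mathrm{Tr}(M_0))+\gamma^2\,\mathrm{Tr}\!\left(M_0(\gamma I-C)^{-1}\right)\ \middle|\ \gamma I\succ C\right\},$$ where $M_0:=\mathbb{E}_{P_0}[ww^\top]$.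
   Context: $N_x=n(T+1)$, where $n,T$ are positive integers. $\mathbb{S}^{N_x}$ is the set of real symmetric $N_x\times N_x$ matrices; $\lambda_{\max}(C)$ is the largest eigenvalue of $C$; $A\succ B$ means that $A-B$ is symmetric positive definite. $\mathcal{M}(\mathbb{R}^{N})$ denotes the collection of Borel probability measures on $\mathbb{R}^{N}$ with finite second moments. $\mathbb{E}_P$ denotes expectation when the random vector $w$ has distribution $P$. The type-2 Wasserstein distance between $P_1,P_2\in\mathcal{M}(\mathbb{R}^{N_x})$ is defined by $$W_2(P_1,P_2)^2:=\inf_{\pi\in\Pi(P_1,P_2)}\int_{\mathbb{R}^{N_x}\times\mathbb{R}^{N_x}}\|z_1-z_2\|^2\,\pi(dz_1,dz_2),$$ where $\|\cdot\|$ is the Euclidean norm and $\Pi(P_1,P_2)$ is the set of all joint distributions in $\mathcal{M}(\mathbb{R}^{N_x}\times\mathbb{R}^{N_x})$ with marginals $P_1$ and $P_2$. *)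

theory Defs
  imports "HOL-Probability.Probability"
begin

(* Borel probability measures with finite second moments. For a product of Euclidean
   spaces, the norm is the Euclidean norm of the concatenated vector. *)
definition second_moment_measures :: "'a::euclidean_space measure set" where
  "second_moment_measures =
     {P. prob_space P \<and> sets P = sets borel \<and> integrable P (\<lambda>w. (norm w)\<^sup>2)}"

definition couplings ::
  "'a::euclidean_space measure \<Rightarrow> 'a measure \<Rightarrow> ('a \<times> 'a) measure set" where
  "couplings P1 P2 =
     {\<pi> \<in> second_moment_measures. distr \<pi> borel fst = P1 \<and> distr \<pi> borel snd = P2}"

(* A real-valued infimum suffices for P1, P2 with finite second moments: the product measure
   is a coupling, every coupling has finite cost, and costs are bounded below by 0. *)
definition wasserstein2 :: "'a::euclidean_space measure \<Rightarrow> 'a measure \<Rightarrow> real" where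
  "wasserstein2 P1 P2 =
     sqrt (INF \<pi>\<in>couplings P1 P2. \<integral>z. (norm (fst z - snd z))\<^sup>2 \<partial>\<pi>)"

definition wasserstein_ball :: "real \<Rightarrow> 'a::euclidean_space measure \<Rightarrow> 'a measure set" where
  "wasserstein_ball r P0 = {P \<in> second_moment_measures. wasserstein2 P P0 \<le> r}"

(* The matrix-valued (Bochner) expectation of w w\<^sup>T. *)
definition second_moment_matrix :: "(real^'n) measure \<Rightarrow> real^'n^'n" where
  "second_moment_matrix P = (\<integral>w. (\<chi> i j. w $ i * w $ j) \<partial>P)"

(* The set of eigenvalues is finite; it is nonempty when C is symmetric, the only case
   in which the value is meaningful. *)
definition lambda_max :: "real^'n^'n \<Rightarrow> real" where
  "lambda_max C = Max {k. \<exists>v. v \<noteq> 0 \<and> C *v v = k *\<^sub>R v}"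

definition pos_definite :: "real^'n^'n \<Rightarrow> bool" where
  "pos_definite A \<longleftrightarrow> transpose A = A \<and> (\<forall>x. x \<noteq> 0 \<longrightarrow> x \<bullet> (A *v x) > 0)"

definition dual_feasible :: "real^'n^'n \<Rightarrow> real set" where
  "dual_feasible C = {\<gamma>. \<gamma> \<ge> 0 \<and> pos_definite (\<gamma> *\<^sub>R mat 1 - C)}"

definition dual_objective :: "real \<Rightarrow> real^'n^'n \<Rightarrow> real^'n^'n \<Rightarrow> real \<Rightarrow> real" where
  "dual_objective r M0 C \<gamma> =
     \<gamma> * (r\<^sup>2 - trace M0) + \<gamma>\<^sup>2 * trace (M0 ** matrix_inv (\<gamma> *\<^sub>R mat 1 - C))"

(* Extended reals make the finiteness of the supremum a genuine claim. The integrand is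
   integrable for every measure in the ball. *)
definition worst_case_value :: "real \<Rightarrow> (real^'n) measure \<Rightarrow> real^'n^'n \<Rightarrow> ereal" where
  "worst_case_value r P0 C =
     (SUP P\<in>wasserstein_ball r P0. ereal (\<integral>w. w \<bullet> (C *v w) \<partial>P))"

definition dual_value :: "real \<Rightarrow> (real^'n) measure \<Rightarrow> real^'n^'n \<Rightarrow> ereal" where
  "dual_value r P0 C =
     (INF \<gamma>\<in>dual_feasible C. ereal (dual_objective r (second_moment_matrix P0) C \<gamma>))"

end

theory Submission
  imports Defs
begin

text \<open>
  Attach a multiplier \<open>\<gamma>\<close> to the transport budget. For a fixed starting point \<open>z\<close>, the penalized
  gain \<open>w\<^sup>T C w - \<gamma> \<parallel>w - z\<parallel>\<^sup>2\<close> of moving \<open>z\<close> to \<open>w\<close> is a concave quadratic in \<open>w\<close> when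
  \<open>\<gamma> I - C\<close> is positive definite. Writing \<open>R = (\<gamma> I - C)\<^sup>-\<^sup>1\<close>, completing the square shows that
  its maximum is \<open>\<gamma>\<^sup>2 z\<^sup>T R z - \<gamma> \<parallel>z\<parallel>\<^sup>2\<close>, reached at \<open>w = \<gamma> R z\<close>. The dual objective is exactly
  \<open>\<gamma> r\<^sup>2\<close> plus the \<open>P0\<close>-expectation of this maximum (\<open>dual_objective_eq_integral\<close>).

  Two consequences are immediate. Integrating the inequality against a nearly optimal coupling
  bounds every primal value by every dual value (\<open>weak_duality\<close>). And since the maximum is a
  supremum of functions affine in \<open>\<gamma>\<close>, the dual objective is convex (\<open>convex_dual_objective\<close>).

  For the converse, push \<open>P0\<close> forward under the linear map \<open>z \<mapsto> \<gamma> R z\<close>. This attains the pointwise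
  maximum, so its value equals the dual objective at \<open>\<gamma>\<close> provided it spends the budget exactly
  or \<open>\<gamma> = 0\<close> (\<open>attained_if_complementary_slackness\<close>). Its displacement is
  \<open>\<gamma> R z - z = C R z\<close>, so a root \<open>\<gamma>\<close> of \<open>g(\<gamma>) = E \<parallel>C R z\<parallel>\<^sup>2 = r\<^sup>2\<close> is sought. The function \<open>g\<close>
  is continuous and tends to \<open>0\<close> at infinity. If the largest eigenvalue \<open>\<lambda>\<close> of \<open>C\<close> is positive,
  with unit eigenvector \<open>v\<close>, then
  \<open>g(\<gamma>) \<ge> \<lambda>\<^sup>2 E (v \<bullet> z)\<^sup>2 / (\<gamma> - \<lambda>)\<^sup>2\<close> blows up as \<open>\<gamma>\<close> decreases to \<open>\<lambda>\<close>: absolute continuity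
  keeps \<open>P0\<close> from living on the hyperplane orthogonal to \<open>v\<close>. If \<open>\<lambda> < 0\<close>, then \<open>\<gamma> = 0\<close> is feasible
  and either \<open>g(0) \<le> r\<^sup>2\<close>, so that \<open>\<gamma> = 0\<close> works, or \<open>g(0) > r\<^sup>2\<close> starts the intermediate value
  argument. So both optimal values are attained and agree.
\<close>

section \<open>The largest eigenvalue of a symmetric matrix\<close>

lemma symmetric_dot:
  fixes C :: "real^'n^'n"
  assumes "transpose C = C"
  shows "x \<bullet> (C *v y) = (C *v x) \<bullet> y"
  by (metis assms dot_lmul_matrix transpose_matrix_vector)

text \<open>
  A zero of a nonnegative quadratic form is a minimum, so its gradient vanishes there. Concretely,
  stepping from \<open>v\<close> against the direction \<open>u = A v\<close> would make the form negative if \<open>u \<noteq> 0\<close>.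
\<close>

lemma psd_form_zero_imp_kernel:
  fixes A :: "real^'n^'n"
  assumes sym: "transpose A = A" and psd: "\<And>x. 0 \<le> x \<bullet> (A *v x)" and zero: "v \<bullet> (A *v v) = 0"
  shows "A *v v = 0"
proof -
  define u where "u = A *v v"
  define q where "q = u \<bullet> (A *v u)"
  \<comment> \<open>The step is short enough that the quadratic term \<open>s\<^sup>2 q\<close> cannot offset the gain \<open>2 s (u \<bullet> u)\<close>;
    the \<open>+ 1\<close> covers \<open>q = 0\<close>.\<close>
  define s where "s = (u \<bullet> u) / (q + 1)"
  have q: "0 \<le> q" unfolding q_def by (rule psd)
  have "0 \<le> (v - s *\<^sub>R u) \<bullet> (A *v (v - s *\<^sub>R u))" by (rule psd)
  also have "\<dots> = s * (s * q - 2 * (u \<bullet> u))"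
    using zero symmetric_dot[OF sym, of v u]
    by (simp add: matrix_vector_mult_diff_distrib matrix_vector_mult_scaleR inner_diff_left inner_diff_right
        u_def[symmetric] q_def algebra_simps)
  finally have le: "0 \<le> s * (s * q - 2 * (u \<bullet> u))" .
  show ?thesis
  proof (rule ccontr)
    assume "A *v v \<noteq> 0"
    then have uu: "0 < u \<bullet> u" by (simp add: u_def)
    then have "0 < s" using q by (simp add: s_def)
    moreover have "s * q \<le> u \<bullet> u"
      using q uu by (simp add: s_def field_simps)
    ultimately show False using le uu by (simp add: zero_le_mult_iff)
  qed
qed

text \<open>
  Eigenvectors of a symmetric matrix for distinct eigenvalues are orthogonal, hence independent, and
  the dimension bounds their number. The set over which \<open>lambda_max\<close> takes a maximum is therefore
  finite.
\<close>

lemma finite_eigenvalues_symmetric: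
  fixes C :: "real^'n^'n"
  assumes sym: "transpose C = C"
  shows "finite {k. \<exists>v. v \<noteq> 0 \<and> C *v v = k *\<^sub>R v}"
proof -
  define S where "S = {k. \<exists>v. v \<noteq> 0 \<and> C *v v = k *\<^sub>R v}"
  define e where "e = (\<lambda>k. SOME v. v \<noteq> 0 \<and> C *v v = k *\<^sub>R v)"
  have e: "e k \<noteq> 0" "C *v e k = k *\<^sub>R e k" if "k \<in> S" for k
  proof -
    have "\<exists>v. v \<noteq> 0 \<and> C *v v = k *\<^sub>R v" using that by (simp add: S_def)
    from someI_ex[OF this] show "e k \<noteq> 0" "C *v e k = k *\<^sub>R e k" by (simp_all add: e_def)
  qed
  have orth: "e k \<bullet> e l = 0" if "k \<in> S" "l \<in> S" "k \<noteq> l" for k l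
    using symmetric_dot[OF sym, of "e k" "e l"] e(2)[OF that(1)] e(2)[OF that(2)] that(3) by simp
  have inj: "inj_on e S"
  proof (rule inj_onI, rule ccontr)
    fix k l assume kl: "k \<in> S" "l \<in> S" "e k = e l" "k \<noteq> l"
    then have "e k \<bullet> e k = 0" using orth[OF kl(1,2,4)] by simp
    then show False using e(1)[OF kl(1)] by simp
  qed
  have "pairwise orthogonal (e ` S)"
    unfolding pairwise_def orthogonal_def using orth by auto
  moreover have "0 \<notin> e ` S" using e(1) by fastforce
  ultimately have "independent (e ` S)" by (rule pairwise_orthogonal_independent)
  then have "finite (e ` S)" by (rule independent_imp_finite)
  then have "finite S" using inj by (rule finite_imageD)
  then show ?thesis by (simp add: S_def)
qed

text \<open>
  The Rayleigh quotient attains its maximum \<open>m\<close> on the compact unit sphere. The form of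
  \<open>m I - C\<close> is then nonnegative and vanishes at the maximizer, so the maximizer is an eigenvector,
  and no eigenvalue can exceed \<open>m\<close>.
\<close>

lemma lambda_max_Rayleigh:
  fixes C :: "real^'n^'n"
  assumes sym: "transpose C = C"
  obtains v where "norm v = 1" "C *v v = lambda_max C *\<^sub>R v"
    "\<And>x. x \<bullet> (C *v x) \<le> lambda_max C * (norm x)\<^sup>2"
proof -
  have "continuous_on (sphere 0 1) (\<lambda>x::real^'n. x \<bullet> (C *v x))"
    by (intro continuous_intros linear_continuous_on) simp
  moreover have "sphere (0::real^'n) 1 \<noteq> {}" by simp
  ultimately obtain v where v: "norm v = 1"
    and max: "\<And>y. norm y = 1 \<Longrightarrow> y \<bullet> (C *v y) \<le> v \<bullet> (C *v v)"
    using continuous_attains_sup[OF compact_sphere, of "0::real^'n" 1 "\<lambda>x. x \<bullet> (C *v x)"] by auto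
  define m where "m = v \<bullet> (C *v v)"
  have bound: "x \<bullet> (C *v x) \<le> m * (norm x)\<^sup>2" for x
  proof (cases "x = 0")
    case False
    have "(x /\<^sub>R norm x) \<bullet> (C *v (x /\<^sub>R norm x)) \<le> m"
      unfolding m_def using False by (intro max) simp
    then show ?thesis using False
      by (simp add: matrix_vector_mult_scaleR field_simps power2_eq_square)
  qed simp
  define A where "A = m *\<^sub>R mat 1 - C"
  have Av: "A *v x = m *\<^sub>R x - C *v x" for x
    by (simp add: A_def matrix_vector_mult_diff_rdistrib scaleR_matrix_vector_assoc[symmetric])
  have "A *v v = 0"
  proof (rule psd_form_zero_imp_kernel)
    show "transpose A = A"
      using sym by (simp add: A_def transpose_def mat_def vec_eq_iff)
    show "0 \<le> x \<bullet> (A *v x)" for x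
      using bound[of x] by (simp add: Av inner_diff_right power2_norm_eq_inner)
    show "v \<bullet> (A *v v) = 0"
      using v by (simp add: Av inner_diff_right m_def norm_eq_1)
  qed
  then have eig: "C *v v = m *\<^sub>R v" by (simp add: Av)
  have "lambda_max C = m"
    unfolding lambda_max_def
  proof (rule Max_eqI[OF finite_eigenvalues_symmetric[OF sym]])
    show "k \<le> m" if "k \<in> {k. \<exists>v. v \<noteq> 0 \<and> C *v v = k *\<^sub>R v}" for k
    proof -
      obtain x where x: "x \<noteq> 0" "C *v x = k *\<^sub>R x" using \<open>k \<in> _\<close> by blast
      then have "k * (norm x)\<^sup>2 \<le> m * (norm x)\<^sup>2"
        using bound[of x] by (simp add: power2_norm_eq_inner)
      then show ?thesis using x(1) by simp
    qed
    show "m \<in> {k. \<exists>v. v \<noteq> 0 \<and> C *v v = k *\<^sub>R v}" using eig v by (auto intro!: exI[of _ v])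
  qed
  with v eig bound that show thesis by simp
qed

section \<open>The resolvent and the penalized problem\<close>

definition shifted :: "real^'n^'n \<Rightarrow> real \<Rightarrow> real^'n^'n" where
  "shifted C \<gamma> = \<gamma> *\<^sub>R mat 1 - C"

lemma shifted_apply: "shifted C \<gamma> *v x = \<gamma> *\<^sub>R x - C *v x"
  by (simp add: shifted_def matrix_vector_mult_diff_rdistrib scaleR_matrix_vector_assoc[symmetric])

lemma transpose_shifted: "transpose C = C \<Longrightarrow> transpose (shifted C \<gamma>) = shifted C \<gamma>"
  by (simp add: shifted_def transpose_def mat_def vec_eq_iff)

lemma shifted_coercive:
  assumes "transpose C = C"
  shows "(\<gamma> - lambda_max C) * (norm x)\<^sup>2 \<le> x \<bullet> (shifted C \<gamma> *v x)"
proof -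
  have "x \<bullet> (C *v x) \<le> lambda_max C * (norm x)\<^sup>2"
    using lambda_max_Rayleigh[OF assms] by metis
  then show ?thesis
    by (simp add: shifted_apply inner_diff_right power2_norm_eq_inner algebra_simps)
qed

lemma dual_feasible_iff:
  assumes sym: "transpose C = C"
  shows "\<gamma> \<in> dual_feasible C \<longleftrightarrow> 0 \<le> \<gamma> \<and> lambda_max C < \<gamma>"
proof -
  have "pos_definite (shifted C \<gamma>) \<longleftrightarrow> lambda_max C < \<gamma>"
  proof
    obtain v where v: "norm v = 1" "C *v v = lambda_max C *\<^sub>R v"
      using lambda_max_Rayleigh[OF sym] by metis
    assume "pos_definite (shifted C \<gamma>)"
    moreover have "v \<noteq> 0" using v(1) by auto
    ultimately have "0 < v \<bullet> (shifted C \<gamma> *v v)"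
      unfolding pos_definite_def by blast
    then show "lambda_max C < \<gamma>"
      using v by (simp add: shifted_apply inner_diff_right norm_eq_1)
  next
    assume less: "lambda_max C < \<gamma>"
    have "0 < x \<bullet> (shifted C \<gamma> *v x)" if "x \<noteq> 0" for x
    proof -
      have "0 < (\<gamma> - lambda_max C) * (norm x)\<^sup>2" using less that by simp
      also note shifted_coercive[OF sym]
      finally show ?thesis .
    qed
    then show "pos_definite (shifted C \<gamma>)"
      by (simp add: pos_definite_def transpose_shifted sym)
  qed
  then show ?thesis by (simp add: dual_feasible_def shifted_def)
qed

definition resolvent :: "real^'n^'n \<Rightarrow> real \<Rightarrow> real^'n^'n" where
  "resolvent C \<gamma> = matrix_inv (shifted C \<gamma>)"

text \<open>
  The maximum over \<open>w\<close> of \<open>w \<bullet> (C *v w) - \<gamma> * (norm (w - z))\<^sup>2\<close> for \<open>\<gamma>\<close> above the largest eigenvalue;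
  the lemmas \<open>penalized_le\<close> and \<open>penalized_eq\<close> below justify the closed form.
\<close>

definition penalized_max :: "real^'n^'n \<Rightarrow> real \<Rightarrow> real^'n \<Rightarrow> real" where
  "penalized_max C \<gamma> z = \<gamma>\<^sup>2 * (z \<bullet> (resolvent C \<gamma> *v z)) - \<gamma> * (norm z)\<^sup>2"

context
  fixes C :: "real^'n^'n"
  assumes sym: "transpose C = C"
begin

lemma invertible_shifted:
  assumes "lambda_max C < \<gamma>"
  shows "invertible (shifted C \<gamma>)"
proof -
  have "x = 0" if "shifted C \<gamma> *v x = 0" for x
  proof -
    have "(\<gamma> - lambda_max C) * (norm x)\<^sup>2 \<le> 0"
      using shifted_coercive[OF sym, of \<gamma> x] that by simp
    then show ?thesis using assms by (simp add: mult_le_0_iff)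
  qed
  then show ?thesis
    by (metis invertible_left_inverse matrix_left_invertible_ker)
qed

lemma matrix_inv_shifted:
  assumes "lambda_max C < \<gamma>"
  shows "shifted C \<gamma> ** resolvent C \<gamma> = mat 1" "resolvent C \<gamma> ** shifted C \<gamma> = mat 1"
  using someI_ex[OF invertible_shifted[OF assms, unfolded invertible_def]]
  by (simp_all add: resolvent_def matrix_inv_def)

lemma shifted_resolvent:
  assumes "lambda_max C < \<gamma>"
  shows "shifted C \<gamma> *v (resolvent C \<gamma> *v x) = x"
  by (simp add: matrix_vector_mul_assoc matrix_inv_shifted[OF assms])

lemma resolvent_shifted:
  assumes "lambda_max C < \<gamma>"
  shows "resolvent C \<gamma> *v (shifted C \<gamma> *v x) = x"
  by (simp add: matrix_vector_mul_assoc matrix_inv_shifted[OF assms])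

text \<open>
  The displacement \<open>\<gamma> R x - x\<close> of the optimal transport map is \<open>C R x\<close>, since
  \<open>(\<gamma> I - C) R x = x\<close>.
\<close>

lemma C_resolvent:
  assumes "lambda_max C < \<gamma>"
  shows "C *v (resolvent C \<gamma> *v x) = \<gamma> *\<^sub>R (resolvent C \<gamma> *v x) - x"
  using shifted_resolvent[OF assms, of x] by (simp add: shifted_apply algebra_simps)

lemma norm_resolvent_le:
  assumes "lambda_max C < \<gamma>"
  shows "norm (resolvent C \<gamma> *v x) \<le> norm x / (\<gamma> - lambda_max C)"
proof -
  define y where "y = resolvent C \<gamma> *v x"
  have "(\<gamma> - lambda_max C) * (norm y)\<^sup>2 \<le> y \<bullet> x"
    using shifted_coercive[OF sym, of \<gamma> y] shifted_resolvent[OF assms, of x] by (simp add: y_def)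
  also have "\<dots> \<le> norm y * norm x" by (rule norm_cauchy_schwarz)
  finally have "norm y * ((\<gamma> - lambda_max C) * norm y) \<le> norm y * norm x"
    by (simp add: power2_eq_square algebra_simps)
  then have "(\<gamma> - lambda_max C) * norm y \<le> norm x"
    by (cases "y = 0") auto
  then show ?thesis using assms by (simp add: y_def field_simps)
qed

lemma complete_square:
  fixes w z :: "real^'n"
  assumes "lambda_max C < \<gamma>"
  defines "d \<equiv> w - \<gamma> *\<^sub>R (resolvent C \<gamma> *v z)"
  shows "w \<bullet> (C *v w) - \<gamma> * (norm (w - z))\<^sup>2
    = penalized_max C \<gamma> z - d \<bullet> (shifted C \<gamma> *v d)"
proof -
  define y where "y = resolvent C \<gamma> *v z"
  have Ay: "shifted C \<gamma> *v y = z" using shifted_resolvent[OF assms(1)] by (simp add: y_def)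
  have w: "w \<bullet> (C *v w) = \<gamma> * (w \<bullet> w) - w \<bullet> (shifted C \<gamma> *v w)"
    by (simp add: shifted_apply inner_diff_right)
  have "y \<bullet> (shifted C \<gamma> *v w) = z \<bullet> w"
    using symmetric_dot[OF transpose_shifted[OF sym], of y \<gamma> w] Ay by simp
  then have "d \<bullet> (shifted C \<gamma> *v d)
      = w \<bullet> (shifted C \<gamma> *v w) - 2 * \<gamma> * (w \<bullet> z) + \<gamma>\<^sup>2 * (z \<bullet> y)"
    unfolding d_def y_def[symmetric] using Ay
    by (simp add: matrix_vector_mult_diff_distrib matrix_vector_mult_scaleR inner_diff_left inner_diff_right
        inner_commute power2_eq_square algebra_simps)
  then show ?thesis unfolding w penalized_max_def y_def[symmetric]
    by (simp add: power2_norm_eq_inner inner_diff_left inner_diff_right inner_commute algebra_simps)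
qed

lemma penalized_le:
  assumes "lambda_max C < \<gamma>"
  shows "w \<bullet> (C *v w) - \<gamma> * (norm (w - z))\<^sup>2
    \<le> penalized_max C \<gamma> z"
proof -
  define d where "d = w - \<gamma> *\<^sub>R (resolvent C \<gamma> *v z)"
  have "0 \<le> (\<gamma> - lambda_max C) * (norm d)\<^sup>2" using assms by simp
  also have "\<dots> \<le> d \<bullet> (shifted C \<gamma> *v d)" by (rule shifted_coercive[OF sym])
  finally show ?thesis unfolding complete_square[OF assms] d_def by simp
qed

lemma penalized_eq:
  fixes z :: "real^'n"
  assumes "lambda_max C < \<gamma>"
  defines "w \<equiv> \<gamma> *\<^sub>R (resolvent C \<gamma> *v z)"
  shows "w \<bullet> (C *v w) - \<gamma> * (norm (w - z))\<^sup>2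
    = penalized_max C \<gamma> z"
  unfolding complete_square[OF assms(1)] w_def by simp

lemma resolvent_identity:
  assumes "lambda_max C < a" "lambda_max C < b"
  shows "resolvent C a *v x - resolvent C b *v x = (b - a) *\<^sub>R (resolvent C a *v (resolvent C b *v x))"
proof -
  define y where "y = resolvent C b *v x"
  have "x = shifted C a *v y + (b - a) *\<^sub>R y"
    using shifted_resolvent[OF assms(2), of x] by (simp add: y_def shifted_apply algebra_simps)
  then have "resolvent C a *v x = y + (b - a) *\<^sub>R (resolvent C a *v y)"
    using resolvent_shifted[OF assms(1), of y]
    by (simp add: matrix_vector_right_distrib matrix_vector_mult_scaleR)
  then show ?thesis by (simp add: y_def)
qed

end

section \<open>Second moments and the dual objective as an expectation\<close>

lemma second_moment_measuresD:
  assumes "P \<in> second_moment_measures"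
  shows "prob_space P" "sets P = sets borel" "space P = UNIV" "integrable P (\<lambda>w. (norm w)\<^sup>2)"
  using assms sets_eq_imp_space_eq[of P borel] by (auto simp: second_moment_measures_def)

lemma continuous_imp_measurable:
  assumes "sets P = sets borel" and "continuous_on UNIV f"
  shows "f \<in> borel_measurable P"
  using borel_measurable_continuous_onI[OF assms(2)] assms(1)
  by (simp cong: measurable_cong_sets)

lemma integrable_quadratic_growth:
  fixes f :: "'a::euclidean_space \<Rightarrow> 'b::{banach, second_countable_topology}"
  assumes P: "P \<in> second_moment_measures"
    and "continuous_on UNIV f" and "\<And>w. norm (f w) \<le> K * (norm w)\<^sup>2"
  shows "integrable P f"
proof (rule Bochner_Integration.integrable_bound)
  show "integrable P (\<lambda>w. K * (norm w)\<^sup>2)"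
    using second_moment_measuresD[OF P] by simp
  show "f \<in> borel_measurable P"
    by (rule continuous_imp_measurable[OF second_moment_measuresD(2)[OF P] assms(2)])
  have "norm (f w) \<le> norm (K * (norm w)\<^sup>2)" for w
    using assms(3)[of w] by simp
  then show "AE w in P. norm (f w) \<le> norm (K * (norm w)\<^sup>2)" by simp
qed

lemma matrix_vector_norm_bound:
  fixes A :: "real^'n^'m"
  obtains K where "K > 0" "\<And>x. norm (A *v x) \<le> K * norm x"
  using linear_bounded_pos[of "(*v) A"] by auto

lemma continuous_matrix_vector [continuous_intros]:
  fixes A :: "real^'n^'m"
  assumes "continuous_on S f"
  shows "continuous_on S (\<lambda>x. A *v f x)"
  by (rule continuous_on_compose2[OF matrix_vector_mult_linear_continuous_on[of UNIV] assms]) simp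

lemma integrable_inner_matrix:
  fixes X Y :: "real^'n^'m"
  assumes P: "P \<in> second_moment_measures"
  shows "integrable P (\<lambda>w. (X *v w) \<bullet> (Y *v w))"
proof -
  obtain K where K: "K > 0" "\<And>x. norm (X *v x) \<le> K * norm x" using matrix_vector_norm_bound[of X] by metis
  obtain L where L: "L > 0" "\<And>x. norm (Y *v x) \<le> L * norm x" using matrix_vector_norm_bound[of Y] by metis
  show ?thesis
  proof (rule integrable_quadratic_growth[OF P, of _ "K * L"])
    show "continuous_on UNIV (\<lambda>w. (X *v w) \<bullet> (Y *v w))" by (intro continuous_intros)
    fix w
    have "norm ((X *v w) \<bullet> (Y *v w)) \<le> norm (X *v w) * norm (Y *v w)"
      by (simp add: Cauchy_Schwarz_ineq2)
    also have "\<dots> \<le> (K * norm w) * (L * norm w)" using K L by (intro mult_mono) auto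
    finally show "norm ((X *v w) \<bullet> (Y *v w)) \<le> K * L * (norm w)\<^sup>2"
      by (simp add: power2_eq_square algebra_simps)
  qed
qed

lemma integrable_quadratic_form:
  fixes X :: "real^'n^'n"
  assumes "P \<in> second_moment_measures"
  shows "integrable P (\<lambda>w. w \<bullet> (X *v w))"
  using integrable_inner_matrix[OF assms, of "mat 1" X] by simp

text \<open>
  The trace against a fixed matrix is a linear functional, so it passes inside the matrix-valued
  expectation, where \<open>tr (w w\<^sup>T X) = w\<^sup>T X w\<close>.
\<close>

lemma trace_second_moment_matrix:
  fixes X :: "real^'n^'n"
  assumes P: "P \<in> second_moment_measures"
  shows "trace (second_moment_matrix P ** X) = (\<integral>w. w \<bullet> (X *v w) \<partial>P)"
proof -
  let ?o = "\<lambda>w::real^'n. (\<chi> i j. w $ i * w $ j) :: real^'n^'n"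
  have lin: "bounded_linear (\<lambda>M. trace (M ** X))"
    unfolding linear_conv_bounded_linear[symmetric]
    by (rule linearI) (simp_all add: trace_def matrix_matrix_mult_def sum.distrib sum_distrib_left algebra_simps)
  have "integrable P ?o"
  proof (rule integrable_quadratic_growth[OF P, of _ "\<Sum>i::'n\<in>UNIV. \<Sum>j::'n\<in>UNIV. 1"])
    show "continuous_on UNIV ?o" by (intro continuous_intros)
    fix w :: "real^'n"
    have "norm (?o w) \<le> (\<Sum>i\<in>UNIV. norm (?o w $ i))"
      by (simp add: norm_vec_def L2_set_le_sum)
    also have "\<dots> \<le> (\<Sum>i\<in>UNIV. \<Sum>j\<in>UNIV. norm (?o w $ i $ j))"
      unfolding norm_vec_def[where 'a=real] by (intro sum_mono L2_set_le_sum) simp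
    also have "\<dots> \<le> (\<Sum>i::'n\<in>UNIV. \<Sum>j::'n\<in>UNIV. (norm w)\<^sup>2)"
      by (intro sum_mono) (simp add: abs_mult power2_eq_square mult_mono component_le_norm_cart)
    finally show "norm (?o w) \<le> (\<Sum>i::'n\<in>UNIV. \<Sum>j::'n\<in>UNIV. 1) * (norm w)\<^sup>2"
      by simp
  qed
  then have "trace (second_moment_matrix P ** X) = (\<integral>w. trace (?o w ** X) \<partial>P)"
    unfolding second_moment_matrix_def by (rule integral_bounded_linear[OF lin, symmetric])
  also have "\<dots> = (\<integral>w. w \<bullet> (X *v w) \<partial>P)"
  proof (rule Bochner_Integration.integral_cong[OF refl])
    fix w
    have "trace (?o w ** X) = (\<Sum>i\<in>UNIV. \<Sum>j\<in>UNIV. w $ j * (X $ j $ i * w $ i))"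
      by (simp add: trace_def matrix_matrix_mult_def algebra_simps)
    also have "\<dots> = w \<bullet> (X *v w)"
      by (subst sum.swap) (simp add: inner_vec_def matrix_vector_mult_def sum_distrib_left)
    finally show "trace (?o w ** X) = w \<bullet> (X *v w)" .
  qed
  finally show ?thesis .
qed

lemma integrable_penalized_max:
  assumes P: "P \<in> second_moment_measures"
  shows "integrable P (penalized_max C \<gamma>)"
  unfolding penalized_max_def
  using integrable_quadratic_form[OF P] second_moment_measuresD(4)[OF P] by simp

lemma dual_objective_eq_integral:
  fixes C :: "real^'n^'n"
  assumes P: "P \<in> second_moment_measures"
  shows "dual_objective r (second_moment_matrix P) C \<gamma>
    = \<gamma> * r\<^sup>2 + integral\<^sup>L P (penalized_max C \<gamma>)"
proof -
  have "trace (second_moment_matrix P) = (\<integral>w. (norm w)\<^sup>2 \<partial>P)"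
    using trace_second_moment_matrix[OF P, of "mat 1"] by (simp add: power2_norm_eq_inner)
  then show ?thesis
    using trace_second_moment_matrix[OF P, of "resolvent C \<gamma>"]
      integrable_quadratic_form[OF P, of "resolvent C \<gamma>"] second_moment_measuresD(4)[OF P]
    by (simp add: dual_objective_def penalized_max_def[abs_def] shifted_def[symmetric] resolvent_def[symmetric] algebra_simps)
qed

text \<open>
  For each \<open>z\<close>, the maximizer \<open>w\<close> at the intermediate multiplier \<open>c\<close> is a competitor at both
  endpoints, and its penalized gain is affine in the multiplier. Hence \<open>penalized_max\<close> is convex in
  \<open>\<gamma>\<close>, and integration preserves this.
\<close>

lemma convex_dual_objective:
  assumes P: "P \<in> second_moment_measures" and sym: "transpose C = C"
  shows "convex_on (dual_feasible C) (dual_objective r (second_moment_matrix P) C)"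
proof (rule convex_onI)
  have "dual_feasible C = {0..} \<inter> {lambda_max C<..}"
    using dual_feasible_iff[OF sym] by auto
  then show cvx: "convex (dual_feasible C)" by (simp add: convex_Int)
  let ?\<phi> = "penalized_max C"
  note int = integrable_penalized_max[OF P]
  fix t a b :: real
  assume t: "0 < t" "t < 1" and ab: "a \<in> dual_feasible C" "b \<in> dual_feasible C"
  define c where "c = (1 - t) *\<^sub>R a + t *\<^sub>R b"
  have "c \<in> dual_feasible C"
    unfolding c_def using cvx t ab by (intro convexD) auto
  then have less: "lambda_max C < a" "lambda_max C < b" "lambda_max C < c"
    using ab dual_feasible_iff[OF sym] by auto
  have "?\<phi> c z \<le> (1 - t) * ?\<phi> a z + t * ?\<phi> b z" for z
  proof -
    define w where "w = c *\<^sub>R (resolvent C c *v z)"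
    let ?q = "\<lambda>\<gamma>. w \<bullet> (C *v w) - \<gamma> * (norm (w - z))\<^sup>2"
    have "?\<phi> c z = ?q c"
      unfolding w_def using penalized_eq[OF sym less(3), of z] by simp
    also have "\<dots> = (1 - t) * ?q a + t * ?q b"
      by (simp add: c_def algebra_simps)
    also have "\<dots> \<le> (1 - t) * ?\<phi> a z + t * ?\<phi> b z"
      using t less
      by (intro add_mono mult_left_mono penalized_le[OF sym]) auto
    finally show ?thesis .
  qed
  then have "integral\<^sup>L P (?\<phi> c) \<le> (\<integral>z. (1 - t) * ?\<phi> a z + t * ?\<phi> b z \<partial>P)"
    using int by (intro integral_mono) auto
  also have "\<dots> = (1 - t) * integral\<^sup>L P (?\<phi> a) + t * integral\<^sup>L P (?\<phi> b)"
    using int by simp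
  finally have "integral\<^sup>L P (?\<phi> c) \<le> (1 - t) * integral\<^sup>L P (?\<phi> a) + t * integral\<^sup>L P (?\<phi> b)" .
  show "dual_objective r (second_moment_matrix P) C ((1 - t) *\<^sub>R a + t *\<^sub>R b)
      \<le> (1 - t) * dual_objective r (second_moment_matrix P) C a
        + t * dual_objective r (second_moment_matrix P) C b"
  proof -
    have "c * r\<^sup>2 = (1 - t) * (a * r\<^sup>2) + t * (b * r\<^sup>2)" by (simp add: c_def algebra_simps)
    with \<open>integral\<^sup>L P (?\<phi> c) \<le> (1 - t) * integral\<^sup>L P (?\<phi> a) + t * integral\<^sup>L P (?\<phi> b)\<close> show ?thesis
      unfolding dual_objective_eq_integral[OF P] c_def[symmetric]
      by (simp only: distrib_left)
  qed
qed

section \<open>Couplings and weak duality\<close>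

text \<open>
  Total mass and the second moment of a joint law are inherited from its marginals, because
  \<open>\<parallel>(x, y)\<parallel>\<^sup>2 = \<parallel>x\<parallel>\<^sup>2 + \<parallel>y\<parallel>\<^sup>2\<close>.
\<close>

lemma couplingI:
  fixes P1 P2 :: "'a::euclidean_space measure"
  assumes P: "P1 \<in> second_moment_measures" "P2 \<in> second_moment_measures"
    and sets: "sets \<pi> = sets borel"
    and marginals: "distr \<pi> borel fst = P1" "distr \<pi> borel snd = P2"
  shows "\<pi> \<in> couplings P1 P2"
proof -
  have meas: "fst \<in> borel_measurable \<pi>" "snd \<in> borel_measurable \<pi>"
    by (intro continuous_imp_measurable[OF sets] continuous_intros)+
  have "prob_space \<pi>"
    using prob_space_distrD[OF meas(1)] second_moment_measuresD(1)[OF P(1)] marginals(1) by simp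
  moreover have "integrable \<pi> (\<lambda>z. (norm z)\<^sup>2)"
  proof -
    have "integrable \<pi> (\<lambda>z. (norm (fst z))\<^sup>2)"
      using second_moment_measuresD(4)[OF P(1)] integrable_distr_eq[OF meas(1), of "\<lambda>w. (norm w)\<^sup>2"]
      unfolding marginals by simp
    moreover have "integrable \<pi> (\<lambda>z. (norm (snd z))\<^sup>2)"
      using second_moment_measuresD(4)[OF P(2)] integrable_distr_eq[OF meas(2), of "\<lambda>w. (norm w)\<^sup>2"]
      unfolding marginals by simp
    ultimately show ?thesis by (simp add: norm_prod_def)
  qed
  ultimately show ?thesis
    using sets marginals by (simp add: couplings_def second_moment_measures_def)
qed

lemma product_coupling:
  fixes P1 P2 :: "'a::euclidean_space measure"
  assumes P: "P1 \<in> second_moment_measures" "P2 \<in> second_moment_measures"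
  shows "P1 \<Otimes>\<^sub>M P2 \<in> couplings P1 P2"
proof (rule couplingI[OF P])
  note D1 = second_moment_measuresD[OF P(1)] and D2 = second_moment_measuresD[OF P(2)]
  interpret P1: prob_space P1 by (rule D1)
  interpret P2: prob_space P2 by (rule D2)
  interpret pair_prob_space P1 P2 ..
  show "sets (P1 \<Otimes>\<^sub>M P2) = sets borel"
    using sets_pair_measure_cong[OF D1(2) D2(2)] unfolding borel_prod .
  show "distr (P1 \<Otimes>\<^sub>M P2) borel fst = P1"
    using P2.distr_pair_fst[of P1] D1(2) by (simp cong: distr_cong)
  have "distr (P1 \<Otimes>\<^sub>M P2) borel snd
      = distr (distr (P2 \<Otimes>\<^sub>M P1) (P1 \<Otimes>\<^sub>M P2) (\<lambda>(x, y). (y, x))) P2 snd"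
    using D2(2) distr_pair_swap by (simp cong: distr_cong)
  also have "\<dots> = distr (P2 \<Otimes>\<^sub>M P1) P2 fst"
    by (subst distr_distr) (auto simp: comp_def case_prod_beta)
  finally show "distr (P1 \<Otimes>\<^sub>M P2) borel snd = P2"
    using P1.distr_pair_fst[of P2] by simp
qed

lemma integrable_transport_cost:
  assumes "\<pi> \<in> couplings P1 P2"
  shows "integrable \<pi> (\<lambda>z. (norm (fst z - snd z))\<^sup>2)"
proof (rule integrable_quadratic_growth)
  show "\<pi> \<in> second_moment_measures" using assms by (simp add: couplings_def)
  show "continuous_on UNIV (\<lambda>z::'a\<times>'a. (norm (fst z - snd z))\<^sup>2)" by (intro continuous_intros)
  fix z :: "'a \<times> 'a"
  have "norm (fst z - snd z) \<le> norm (fst z) + norm (snd z)" by (rule norm_triangle_ineq4)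
  also have "\<dots> \<le> 2 * norm z"
    using norm_fst_le[of "fst z" "snd z"] norm_snd_le[of "snd z" "fst z"] by simp
  finally have "(norm (fst z - snd z))\<^sup>2 \<le> (2 * norm z)\<^sup>2" by (rule power_mono) simp
  then show "norm ((norm (fst z - snd z))\<^sup>2) \<le> 4 * (norm z)\<^sup>2" by (simp add: power_mult_distrib)
qed

lemma wasserstein2_le_cost:
  assumes "\<pi> \<in> couplings P1 P2"
  shows "wasserstein2 P1 P2 \<le> sqrt (\<integral>z. (norm (fst z - snd z))\<^sup>2 \<partial>\<pi>)"
  unfolding wasserstein2_def
  by (intro real_sqrt_le_mono cINF_lower[OF _ assms] bdd_belowI2[of _ 0]) simp

text \<open>
  The product coupling makes the set of couplings nonempty, without which the real-valued infimum
  would say nothing.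
\<close>

lemma near_optimal_coupling:
  assumes P: "P1 \<in> second_moment_measures" "P2 \<in> second_moment_measures"
    and r: "0 \<le> r" and le: "wasserstein2 P1 P2 \<le> r" and e: "0 < e"
  obtains \<pi> where "\<pi> \<in> couplings P1 P2" "(\<integral>z. (norm (fst z - snd z))\<^sup>2 \<partial>\<pi>) < r\<^sup>2 + e"
proof -
  let ?I = "INF \<pi>\<in>couplings P1 P2. \<integral>z. (norm (fst z - snd z))\<^sup>2 \<partial>\<pi>"
  have "?I \<le> r\<^sup>2"
    using le r by (metis wasserstein2_def real_sqrt_le_iff real_sqrt_unique)
  then have "?I < r\<^sup>2 + e" using e by simp
  moreover have "couplings P1 P2 \<noteq> {}" using product_coupling[OF P] by auto
  ultimately show thesis using that cInf_lessD[of "_ ` couplings P1 P2"] by blast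
qed

text \<open>
  Integrate \<open>w\<^sup>T C w \<le> \<gamma> \<parallel>w - z\<parallel>\<^sup>2 + penalized_max C \<gamma> z\<close> against a coupling of \<open>P\<close> and \<open>P0\<close>.
  An optimal coupling is avoided by allowing a cost slightly above \<open>r\<^sup>2\<close>, whose effect vanishes in
  the limit.
\<close>

lemma weak_duality:
  fixes C :: "real^'n^'n"
  assumes sym: "transpose C = C" and r: "0 \<le> r" and P0: "P0 \<in> second_moment_measures"
    and P: "P \<in> wasserstein_ball r P0" and \<gamma>: "\<gamma> \<in> dual_feasible C"
  shows "(\<integral>w. w \<bullet> (C *v w) \<partial>P) \<le> dual_objective r (second_moment_matrix P0) C \<gamma>"
proof (rule field_le_epsilon)
  fix e :: real assume "0 < e"
  have PM: "P \<in> second_moment_measures" and W: "wasserstein2 P P0 \<le> r"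
    using P by (auto simp: wasserstein_ball_def)
  have less: "lambda_max C < \<gamma>" and pos: "0 \<le> \<gamma>" using \<gamma> dual_feasible_iff[OF sym] by auto
  \<comment> \<open>The excess cost is weighted by \<open>\<gamma>\<close>; the \<open>+ 1\<close> covers \<open>\<gamma> = 0\<close>.\<close>
  define d where "d = e / (\<gamma> + 1)"
  have d: "0 < d" "\<gamma> * d \<le> e"
    using \<open>0 < e\<close> pos by (auto simp: d_def field_simps)
  obtain \<pi> where \<pi>: "\<pi> \<in> couplings P P0"
    and cost: "(\<integral>z. (norm (fst z - snd z))\<^sup>2 \<partial>\<pi>) < r\<^sup>2 + d"
    by (rule near_optimal_coupling[OF PM P0 r W d(1)])
  have marg: "distr \<pi> borel fst = P" "distr \<pi> borel snd = P0" and sets: "sets \<pi> = sets borel"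
    using \<pi> by (auto simp: couplings_def second_moment_measures_def)
  have meas: "fst \<in> borel_measurable \<pi>" "snd \<in> borel_measurable \<pi>"
    by (intro continuous_imp_measurable[OF sets] continuous_intros)+
  define f where "f = (\<lambda>w. w \<bullet> (C *v w))"
  let ?\<phi> = "penalized_max C \<gamma>"
  have mf: "f \<in> borel_measurable borel" and m\<phi>: "?\<phi> \<in> borel_measurable borel"
    unfolding f_def penalized_max_def by (intro borel_measurable_continuous_onI continuous_intros)+
  have intf: "integrable P f" unfolding f_def by (rule integrable_quadratic_form[OF PM])
  have int\<phi>: "integrable P0 ?\<phi>" by (rule integrable_penalized_max[OF P0])
  have intf': "integrable \<pi> (\<lambda>z. f (fst z))" and int\<phi>': "integrable \<pi> (\<lambda>z. ?\<phi> (snd z))"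
    using intf int\<phi> integrable_distr_eq[OF meas(1) mf] integrable_distr_eq[OF meas(2) m\<phi>]
    unfolding marg by auto
  note intc = integrable_transport_cost[OF \<pi>]
  have "integral\<^sup>L P f = (\<integral>z. f (fst z) \<partial>\<pi>)"
    using integral_distr[OF meas(1) mf] by (simp add: marg)
  also have "\<dots> \<le> (\<integral>z. \<gamma> * (norm (fst z - snd z))\<^sup>2 + ?\<phi> (snd z) \<partial>\<pi>)"
  proof (rule integral_mono)
    show "f (fst z) \<le> \<gamma> * (norm (fst z - snd z))\<^sup>2 + ?\<phi> (snd z)" for z
      using penalized_le[OF sym less, of "fst z" "snd z"] by (simp add: f_def)
  qed (use intf' int\<phi>' intc in auto)
  also have "\<dots> = \<gamma> * (\<integral>z. (norm (fst z - snd z))\<^sup>2 \<partial>\<pi>) + (\<integral>z. ?\<phi> (snd z) \<partial>\<pi>)"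
    using intc int\<phi>' by simp
  also have "(\<integral>z. ?\<phi> (snd z) \<partial>\<pi>) = integral\<^sup>L P0 ?\<phi>"
    using integral_distr[OF meas(2) m\<phi>] by (simp add: marg)
  also have "\<gamma> * (\<integral>z. (norm (fst z - snd z))\<^sup>2 \<partial>\<pi>) \<le> \<gamma> * (r\<^sup>2 + d)"
    using cost pos by (intro mult_left_mono) auto
  finally show "integral\<^sup>L P (\<lambda>w. w \<bullet> (C *v w)) \<le> dual_objective r (second_moment_matrix P0) C \<gamma> + e"
    unfolding dual_objective_eq_integral[OF P0] f_def[symmetric]
    using d(2) by (simp add: algebra_simps)
qed

section \<open>Attainment by a linear pushforward\<close>

text \<open>
  The cost of transporting \<open>P0\<close> by the map \<open>z \<mapsto> \<gamma> R z\<close>, written with the displacement given by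
  \<open>C_resolvent\<close>.
\<close>

definition displacement_cost :: "(real^'n) measure \<Rightarrow> real^'n^'n \<Rightarrow> real \<Rightarrow> real" where
  "displacement_cost P0 C \<gamma> = (\<integral>z. (norm (C *v (resolvent C \<gamma> *v z)))\<^sup>2 \<partial>P0)"

lemma integrable_displacement:
  assumes P: "P0 \<in> second_moment_measures"
  shows "integrable P0 (\<lambda>z. (norm (C *v (resolvent C \<gamma> *v z)))\<^sup>2)"
  using integrable_inner_matrix[OF P, of "C ** resolvent C \<gamma>" "C ** resolvent C \<gamma>"]
  by (simp add: power2_norm_eq_inner matrix_vector_mul_assoc)

text \<open>
  The joint law of \<open>(B z, z)\<close> is a coupling, so its cost bounds the Wasserstein distance.
\<close>

lemma linear_pushforward:
  fixes B :: "real^'n^'n"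
  assumes P0: "P0 \<in> second_moment_measures"
  defines "P \<equiv> distr P0 borel ((*v) B)"
  shows "P \<in> second_moment_measures"
    and "wasserstein2 P P0 \<le> sqrt (\<integral>z. (norm (B *v z - z))\<^sup>2 \<partial>P0)"
    and "(\<integral>w. w \<bullet> (X *v w) \<partial>P) = (\<integral>z. (B *v z) \<bullet> (X *v (B *v z)) \<partial>P0)"
proof -
  note D = second_moment_measuresD[OF P0]
  have mB: "(*v) B \<in> borel_measurable P0"
    by (intro continuous_imp_measurable[OF D(2)] continuous_intros)
  show PM: "P \<in> second_moment_measures"
    unfolding second_moment_measures_def P_def
    using integrable_inner_matrix[OF P0, of B B] prob_space.prob_space_distr[OF D(1) mB]
      integrable_distr_eq[OF mB, of "\<lambda>w. (norm w)\<^sup>2"]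
    by (simp add: power2_norm_eq_inner)
  let ?T = "\<lambda>z. (B *v z, z)"
  have mT: "?T \<in> borel_measurable P0"
    by (intro continuous_imp_measurable[OF D(2)] continuous_intros)
  have "distr P0 borel ?T \<in> couplings P P0"
  proof (rule couplingI[OF PM P0])
    show "distr (distr P0 borel ?T) borel fst = P"
      using mT unfolding P_def
      by (subst distr_distr) (simp_all add: comp_def borel_measurable_continuous_onI continuous_on_fst continuous_on_snd)
    have "distr (distr P0 borel ?T) borel snd = distr P0 borel (\<lambda>x. x)"
      using mT
      by (subst distr_distr) (simp_all add: comp_def borel_measurable_continuous_onI continuous_on_fst continuous_on_snd)
    also have "\<dots> = P0" using D(2) distr_id2 by metis
    finally show "distr (distr P0 borel ?T) borel snd = P0" .
  qed simp
  note wasserstein2_le_cost[OF this]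
  also have "(\<integral>z. (norm (fst z - snd z))\<^sup>2 \<partial>distr P0 borel ?T) = (\<integral>z. (norm (B *v z - z))\<^sup>2 \<partial>P0)"
    by (subst integral_distr[OF mT]) (simp_all, intro borel_measurable_continuous_onI continuous_intros)
  finally show "wasserstein2 P P0 \<le> sqrt (\<integral>z. (norm (B *v z - z))\<^sup>2 \<partial>P0)" .
  show "(\<integral>w. w \<bullet> (X *v w) \<partial>P) = (\<integral>z. (B *v z) \<bullet> (X *v (B *v z)) \<partial>P0)"
    unfolding P_def
    by (subst integral_distr[OF mB]) (simp_all, intro borel_measurable_continuous_onI continuous_intros)
qed

text \<open>
  The pushforward under \<open>z \<mapsto> \<gamma> R z\<close> reaches the pointwise maximum of the penalized gain. Its value
  is the dual objective minus \<open>\<gamma>\<close> times the unspent budget, and that product vanishes.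
\<close>

lemma attained_if_complementary_slackness:
  fixes C :: "real^'n^'n"
  assumes sym: "transpose C = C" and r: "0 \<le> r" and P0: "P0 \<in> second_moment_measures"
    and \<gamma>: "\<gamma> \<in> dual_feasible C"
    and le: "displacement_cost P0 C \<gamma> \<le> r\<^sup>2"
    and slack: "\<gamma> * (r\<^sup>2 - displacement_cost P0 C \<gamma>) = 0"
  shows "\<exists>P\<in>wasserstein_ball r P0.
    (\<integral>w. w \<bullet> (C *v w) \<partial>P) = dual_objective r (second_moment_matrix P0) C \<gamma>"
proof -
  have less: "lambda_max C < \<gamma>" using \<gamma> dual_feasible_iff[OF sym] by auto
  define B where "B = \<gamma> *\<^sub>R resolvent C \<gamma>"
  have B: "B *v z = \<gamma> *\<^sub>R (resolvent C \<gamma> *v z)" for z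
    by (simp add: B_def scaleR_matrix_vector_assoc)
  have shift: "B *v z - z = C *v (resolvent C \<gamma> *v z)" for z
    unfolding B C_resolvent[OF sym less] ..
  define P where "P = distr P0 borel ((*v) B)"
  note push = linear_pushforward[OF P0, of B, folded P_def]
  have "wasserstein2 P P0 \<le> sqrt (r\<^sup>2)"
    using push(2) le unfolding shift displacement_cost_def[symmetric]
    by (meson order_trans real_sqrt_le_mono)
  then have ball: "P \<in> wasserstein_ball r P0"
    using push(1) r by (simp add: wasserstein_ball_def)
  let ?\<phi> = "penalized_max C \<gamma>"
  have int\<phi>: "integrable P0 ?\<phi>" by (rule integrable_penalized_max[OF P0])
  note intc = integrable_displacement[OF P0]
  have "(B *v z) \<bullet> (C *v (B *v z)) = \<gamma> * (norm (C *v (resolvent C \<gamma> *v z)))\<^sup>2 + ?\<phi> z" for z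
    using penalized_eq[OF sym less, of z] unfolding B[symmetric] shift by simp
  then have "(\<integral>w. w \<bullet> (C *v w) \<partial>P) = \<gamma> * displacement_cost P0 C \<gamma> + integral\<^sup>L P0 ?\<phi>"
    unfolding push(3) displacement_cost_def using int\<phi> intc by simp
  also have "\<dots> = dual_objective r (second_moment_matrix P0) C \<gamma>"
    unfolding dual_objective_eq_integral[OF P0]
    using slack by (auto simp: algebra_simps)
  finally show ?thesis using ball by blast
qed

section \<open>A multiplier that spends the budget\<close>

text \<open>
  On \<open>[a, \<infinity>)\<close> the resolvents are bounded by \<open>1 / d\<close>, where \<open>d\<close> is the distance of \<open>a\<close> to the
  largest eigenvalue. The resolvent identity then makes \<open>\<gamma> \<mapsto> C R z\<close> Lipschitz, and the difference
  of squares factors into a Lipschitz and a bounded term, both proportional to \<open>\<parallel>z\<parallel>\<close>.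
\<close>

lemma displacement_cost_continuous:
  fixes C :: "real^'n^'n"
  assumes sym: "transpose C = C" and P0: "P0 \<in> second_moment_measures"
    and a: "lambda_max C < a"
  shows "continuous_on {a..} (displacement_cost P0 C)"
proof -
  obtain K where K: "K > 0" "\<And>x. norm (C *v x) \<le> K * norm x" using matrix_vector_norm_bound[of C] by metis
  define d where "d = a - lambda_max C"
  have d: "0 < d" using a by (simp add: d_def)
  define S where "S = (\<integral>z. (norm z)\<^sup>2 \<partial>P0)"
  define L where "L = 2 * K\<^sup>2 / d ^ 3 * S"
  let ?T = "\<lambda>\<gamma> z. C *v (resolvent C \<gamma> *v z)"
  note intc = integrable_displacement[OF P0]
  have R: "norm (resolvent C \<gamma> *v z) \<le> norm z / d" if "a \<le> \<gamma>" for \<gamma> z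
  proof -
    have "norm (resolvent C \<gamma> *v z) \<le> norm z / (\<gamma> - lambda_max C)"
      using that a by (intro norm_resolvent_le[OF sym]) simp
    also have "\<dots> \<le> norm z / d" using that d by (intro divide_left_mono) (auto simp: d_def)
    finally show ?thesis .
  qed
  have T: "norm (?T \<gamma> z) \<le> K * (norm z / d)" if "a \<le> \<gamma>" for \<gamma> z
    using K(2)[of "resolvent C \<gamma> *v z"] R[OF that, of z] K(1) by (meson mult_left_mono order_trans less_imp_le)
  have pointwise: "\<bar>(norm (?T s z))\<^sup>2 - (norm (?T t z))\<^sup>2\<bar> \<le> 2 * K\<^sup>2 / d ^ 3 * \<bar>s - t\<bar> * (norm z)\<^sup>2"
    if st: "a \<le> s" "a \<le> t" for s t z
  proof -
    have "norm (?T s z - ?T t z) = norm (C *v ((t - s) *\<^sub>R (resolvent C s *v (resolvent C t *v z))))"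
      using resolvent_identity[OF sym, of s t z] st a
      by (simp add: matrix_vector_mult_diff_distrib[symmetric])
    also have "\<dots> \<le> K * (\<bar>s - t\<bar> * (norm z / d / d))"
    proof -
      have "norm (resolvent C s *v (resolvent C t *v z)) \<le> norm (resolvent C t *v z) / d"
        by (rule R[OF st(1)])
      also have "\<dots> \<le> norm z / d / d" using R[OF st(2)] d by (intro divide_right_mono) auto
      finally have "norm ((t - s) *\<^sub>R (resolvent C s *v (resolvent C t *v z))) \<le> \<bar>s - t\<bar> * (norm z / d / d)"
        using mult_left_mono[OF _ abs_ge_zero[of "s - t"]]
        unfolding norm_scaleR real_norm_def abs_minus_commute[of t s] by blast
      then show ?thesis using K by (meson mult_left_mono order_trans less_imp_le)
    qed
    finally have diff: "norm (?T s z - ?T t z) \<le> K * (\<bar>s - t\<bar> * (norm z / d / d))" .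
    have "\<bar>(norm (?T s z))\<^sup>2 - (norm (?T t z))\<^sup>2\<bar>
        = \<bar>norm (?T s z) - norm (?T t z)\<bar> * (norm (?T s z) + norm (?T t z))"
      by (simp add: power2_eq_square square_diff_square_factored abs_mult mult.commute)
    also have "\<dots> \<le> (K * (\<bar>s - t\<bar> * (norm z / d / d))) * (K * (norm z / d) + K * (norm z / d))"
      using T[OF st(1)] T[OF st(2)] diff norm_triangle_ineq3[of "?T s z" "?T t z"] d K(1)
      by (intro mult_mono add_mono) auto
    also have "\<dots> = 2 * K\<^sup>2 / d ^ 3 * \<bar>s - t\<bar> * (norm z)\<^sup>2"
      using d by (simp add: field_simps power2_eq_square power3_eq_cube)
    finally show ?thesis .
  qed
  have "L-lipschitz_on {a..} (displacement_cost P0 C)"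
  proof (rule lipschitz_onI)
    show "0 \<le> L" using d by (simp add: L_def S_def)
    fix s t assume "s \<in> {a..}" "t \<in> {a..}"
    then have st: "a \<le> s" "a \<le> t" by auto
    have "dist (displacement_cost P0 C s) (displacement_cost P0 C t)
        = \<bar>\<integral>z. (norm (?T s z))\<^sup>2 - (norm (?T t z))\<^sup>2 \<partial>P0\<bar>"
      using intc by (simp add: displacement_cost_def dist_real_def)
    also have "\<dots> \<le> (\<integral>z. \<bar>(norm (?T s z))\<^sup>2 - (norm (?T t z))\<^sup>2\<bar> \<partial>P0)"
      by (rule integral_abs_bound)
    also have "\<dots> \<le> (\<integral>z. 2 * K\<^sup>2 / d ^ 3 * \<bar>s - t\<bar> * (norm z)\<^sup>2 \<partial>P0)"
      using intc second_moment_measuresD(4)[OF P0] pointwise[OF st]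
      by (intro integral_mono) auto
    also have "\<dots> = L * dist s t"
      by (simp add: L_def S_def dist_real_def)
    finally show "dist (displacement_cost P0 C s) (displacement_cost P0 C t) \<le> L * dist s t" .
  qed
  then show ?thesis by (rule lipschitz_on_continuous_on)
qed

text \<open>
  \<open>\<parallel>C R z\<parallel> \<le> K \<parallel>z\<parallel> / (b - \<lambda>)\<close> tends to \<open>0\<close> as \<open>b\<close> grows; here \<open>\<lambda>\<close> is the largest eigenvalue and
  \<open>K\<close> bounds \<open>C\<close>.
\<close>

lemma displacement_cost_small:
  fixes C :: "real^'n^'n"
  assumes sym: "transpose C = C" and P0: "P0 \<in> second_moment_measures" and r: "0 < r"
  obtains b where "m \<le> b" "displacement_cost P0 C b \<le> r\<^sup>2"
proof -
  obtain K where K: "K > 0" "\<And>x. norm (C *v x) \<le> K * norm x" using matrix_vector_norm_bound[of C] by metis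
  define S where "S = (\<integral>z. (norm z)\<^sup>2 \<partial>P0)"
  define q where "q = K\<^sup>2 * S / r\<^sup>2"
  have q: "0 \<le> q" by (simp add: q_def S_def)
  \<comment> \<open>The gap \<open>d\<close> to the largest eigenvalue must satisfy \<open>q \<le> d\<^sup>2\<close>; the summand \<open>1\<close> gives \<open>d \<le> d\<^sup>2\<close>,
    so that \<open>q \<le> d\<close> is enough.\<close>
  define b where "b = max m (lambda_max C + 1 + q)"
  define d where "d = b - lambda_max C"
  have d: "1 + q \<le> d" by (simp add: d_def b_def)
  then have d1: "1 \<le> d" using q by simp
  have less: "lambda_max C < b" using d1 by (simp add: d_def)
  have T: "(norm (C *v (resolvent C b *v z)))\<^sup>2 \<le> K\<^sup>2 / d\<^sup>2 * (norm z)\<^sup>2" for z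
  proof -
    have "norm (C *v (resolvent C b *v z)) \<le> K * norm (resolvent C b *v z)" by (rule K(2))
    also have "\<dots> \<le> K * (norm z / d)"
      using norm_resolvent_le[OF sym less, of z] K(1)
      unfolding d_def by (intro mult_left_mono) auto
    finally have "(norm (C *v (resolvent C b *v z)))\<^sup>2 \<le> (K * (norm z / d))\<^sup>2" by (rule power_mono) simp
    then show ?thesis by (simp add: power_mult_distrib power_divide)
  qed
  have "displacement_cost P0 C b \<le> (\<integral>z. K\<^sup>2 / d\<^sup>2 * (norm z)\<^sup>2 \<partial>P0)"
    unfolding displacement_cost_def
    using integrable_displacement[OF P0] second_moment_measuresD(4)[OF P0] T
    by (intro integral_mono) auto
  also have "\<dots> = K\<^sup>2 * S / d\<^sup>2" by (simp add: S_def)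
  also have "\<dots> = q * r\<^sup>2 / d\<^sup>2" using r by (simp add: q_def)
  also have "\<dots> \<le> r\<^sup>2"
  proof -
    have "q \<le> d" "d \<le> d\<^sup>2" using d d1 by (simp_all add: power2_eq_square)
    then have "q \<le> d\<^sup>2" by simp
    then have "q * r\<^sup>2 \<le> d\<^sup>2 * r\<^sup>2" by (rule mult_right_mono) simp
    then show ?thesis using d1 by (simp add: divide_le_eq mult.commute)
  qed
  finally show thesis using that[of b] by (simp add: b_def)
qed

text \<open>
  If the moment were zero, \<open>P0\<close> would be concentrated on the hyperplane orthogonal to \<open>v\<close>, which
  is Lebesgue null and hence \<open>P0\<close>-null.
\<close>

lemma second_moment_along_direction_pos:
  fixes v :: "real^'n"
  assumes P0: "P0 \<in> second_moment_measures" and ac: "absolutely_continuous lborel P0"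
    and v: "v \<noteq> 0"
  shows "0 < (\<integral>z. (v \<bullet> z)\<^sup>2 \<partial>P0)"
proof -
  note D = second_moment_measuresD[OF P0]
  interpret prob_space P0 by (rule D)
  have int: "integrable P0 (\<lambda>z. (v \<bullet> z)\<^sup>2)"
  proof (rule integrable_quadratic_growth[OF P0, of _ "(norm v)\<^sup>2"])
    show "continuous_on UNIV (\<lambda>z. (v \<bullet> z)\<^sup>2)" by (intro continuous_intros)
    show "norm ((v \<bullet> z)\<^sup>2) \<le> (norm v)\<^sup>2 * (norm z)\<^sup>2" for z
      using Cauchy_Schwarz_ineq[of v z] by (simp add: power2_norm_eq_inner)
  qed
  have "(\<integral>z. (v \<bullet> z)\<^sup>2 \<partial>P0) \<noteq> 0"
  proof
    assume "(\<integral>z. (v \<bullet> z)\<^sup>2 \<partial>P0) = 0"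
    then have ae: "AE z in P0. v \<bullet> z = 0"
      using integral_nonneg_eq_0_iff_AE[OF int] by simp
    have "{z. v \<bullet> z = 0} \<in> null_sets lborel"
    proof -
      have "{z. v \<bullet> z = 0} \<in> null_sets lebesgue"
        using negligible_hyperplane[of v 0] v negligible_iff_null_sets by blast
      moreover have "closed {z. v \<bullet> z = 0}" by (rule closed_hyperplane)
      ultimately show ?thesis
        by (simp add: null_sets_completion_iff borel_closed)
    qed
    then have "{z. v \<bullet> z = 0} \<in> null_sets P0"
      using ac by (auto simp: absolutely_continuous_def)
    then have "AE z in P0. v \<bullet> z \<noteq> 0"
      using AE_not_in by fastforce
    with ae have "AE z in P0. False" by eventually_elim simp
    then show False by simp
  qed
  moreover have "0 \<le> (\<integral>z. (v \<bullet> z)\<^sup>2 \<partial>P0)" by simp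
  ultimately show ?thesis by linarith
qed

text \<open>
  Along the top eigenvector \<open>v\<close> the displacement is \<open>v \<bullet> (C R z) = \<lambda> / (a - \<lambda>) * (v \<bullet> z)\<close>, with \<open>\<lambda>\<close>
  the largest eigenvalue. The gap \<open>d = a - \<lambda>\<close> is chosen so that this component alone costs
  exactly \<open>r\<^sup>2\<close>.
\<close>

lemma displacement_cost_large:
  fixes C :: "real^'n^'n"
  assumes sym: "transpose C = C" and P0: "P0 \<in> second_moment_measures"
    and ac: "absolutely_continuous lborel P0" and pos: "0 < lambda_max C" and r: "0 < r"
  obtains a where "lambda_max C < a" "r\<^sup>2 \<le> displacement_cost P0 C a"
proof -
  obtain v where v: "norm v = 1" "C *v v = lambda_max C *\<^sub>R v"
    using lambda_max_Rayleigh[OF sym] by metis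
  define s where "s = (\<integral>z. (v \<bullet> z)\<^sup>2 \<partial>P0)"
  have s: "0 < s"
    unfolding s_def using second_moment_along_direction_pos[OF P0 ac, of v] v(1) by fastforce
  define d where "d = lambda_max C * sqrt s / r"
  have d: "0 < d" using pos s r by (simp add: d_def)
  define a where "a = lambda_max C + d"
  have less: "lambda_max C < a" using d by (simp add: a_def)
  have lower: "(r\<^sup>2 / s) * (v \<bullet> z)\<^sup>2 \<le> (norm (C *v (resolvent C a *v z)))\<^sup>2" for z
  proof -
    define y where "y = resolvent C a *v z"
    have "v \<bullet> z = v \<bullet> (shifted C a *v y)"
      using shifted_resolvent[OF sym less, of z] by (simp add: y_def)
    also have "\<dots> = d * (v \<bullet> y)"
      using symmetric_dot[OF sym, of v y] v(2)
      by (simp add: shifted_apply inner_diff_right a_def algebra_simps)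
    finally have vz: "v \<bullet> z = d * (v \<bullet> y)" .
    have "v \<bullet> (C *v y) = lambda_max C * (v \<bullet> y)"
      using symmetric_dot[OF sym, of v y] v(2) by simp
    then have "(r\<^sup>2 / s) * (v \<bullet> z)\<^sup>2 = (v \<bullet> (C *v y))\<^sup>2"
      using s r unfolding vz by (simp add: d_def power_mult_distrib power_divide)
    also have "\<dots> \<le> (norm (C *v y))\<^sup>2"
      using Cauchy_Schwarz_ineq[of v "C *v y"] v(1) by (simp add: power2_norm_eq_inner norm_eq_1)
    finally show ?thesis by (simp add: y_def)
  qed
  have "r\<^sup>2 = (\<integral>z. (r\<^sup>2 / s) * (v \<bullet> z)\<^sup>2 \<partial>P0)" using s by (simp add: s_def)
  also have "\<dots> \<le> displacement_cost P0 C a"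
    unfolding displacement_cost_def
  proof (rule integral_mono')
    show "integrable P0 (\<lambda>z. (norm (C *v (resolvent C a *v z)))\<^sup>2)"
      by (rule integrable_displacement[OF P0])
  qed (use lower in auto)
  finally show thesis using that less by blast
qed

text \<open>
  Either \<open>\<gamma> = 0\<close> is feasible and within budget, or the cost is at least \<open>r\<^sup>2\<close> at some feasible point
  and the intermediate value theorem gives a multiplier of cost exactly \<open>r\<^sup>2\<close>. A largest eigenvalue
  equal to \<open>0\<close> falls under neither case, as \<open>\<gamma> = 0\<close> is infeasible and the cost need not blow up.
\<close>

lemma slack_multiplier_exists:
  fixes C :: "real^'n^'n"
  assumes sym: "transpose C = C" and P0: "P0 \<in> second_moment_measures"
    and ac: "absolutely_continuous lborel P0" and nz: "lambda_max C \<noteq> 0" and r: "0 < r"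
  obtains \<gamma> where "\<gamma> \<in> dual_feasible C" "displacement_cost P0 C \<gamma> \<le> r\<^sup>2"
    "\<gamma> * (r\<^sup>2 - displacement_cost P0 C \<gamma>) = 0"
proof (cases "lambda_max C < 0 \<and> displacement_cost P0 C 0 \<le> r\<^sup>2")
  case True
  then show thesis using that[of 0] dual_feasible_iff[OF sym] by simp
next
  case False
  obtain a where a: "0 \<le> a" "lambda_max C < a" "r\<^sup>2 \<le> displacement_cost P0 C a"
  proof (cases "lambda_max C < 0")
    case True
    with False that[of 0] show thesis by simp
  next
    case nonneg: False
    then obtain a where "lambda_max C < a" "r\<^sup>2 \<le> displacement_cost P0 C a"
      using displacement_cost_large[OF sym P0 ac _ r] nz by auto
    with nonneg that[of a] show thesis by simp
  qed
  obtain b where b: "a \<le> b" "displacement_cost P0 C b \<le> r\<^sup>2"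
    by (rule displacement_cost_small[OF sym P0 r])
  have "continuous_on {a..b} (displacement_cost P0 C)"
    by (rule continuous_on_subset[OF displacement_cost_continuous[OF sym P0 a(2)]]) auto
  then obtain \<gamma> where "a \<le> \<gamma>" "displacement_cost P0 C \<gamma> = r\<^sup>2"
    using IVT2'[OF b(2) a(3) b(1)] by auto
  then show thesis using that[of \<gamma>] a dual_feasible_iff[OF sym] by simp
qed

section \<open>Strong duality\<close>

theorem theorem2:
  fixes n T :: nat and r :: real
    and P0 :: "(real^'N) measure" and C :: "real^'N^'N"
  assumes "n > 0" and "T > 0" and "CARD('N) = n * (T + 1)"
    and "r > 0"
    and "P0 \<in> second_moment_measures"
    and "absolutely_continuous lborel P0"
    and "transpose C = C"
    and "lambda_max C \<noteq> 0"
  shows "\<bar>worst_case_value r P0 C\<bar> \<noteq> \<infinity>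
    \<and> worst_case_value r P0 C = dual_value r P0 C
    \<and> convex_on (dual_feasible C) (dual_objective r (second_moment_matrix P0) C)"
proof -
  note r = \<open>r > 0\<close> and P0 = \<open>P0 \<in> second_moment_measures\<close> and sym = \<open>transpose C = C\<close>
  let ?h = "dual_objective r (second_moment_matrix P0) C"
  obtain \<gamma> where \<gamma>: "\<gamma> \<in> dual_feasible C" "displacement_cost P0 C \<gamma> \<le> r\<^sup>2"
    "\<gamma> * (r\<^sup>2 - displacement_cost P0 C \<gamma>) = 0"
    by (rule slack_multiplier_exists[OF sym P0 assms(6) assms(8) r])
  obtain P where P: "P \<in> wasserstein_ball r P0" "(\<integral>w. w \<bullet> (C *v w) \<partial>P) = ?h \<gamma>"
    using attained_if_complementary_slackness[OF sym _ P0 \<gamma>] r by auto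
  have weak: "(\<integral>w. w \<bullet> (C *v w) \<partial>Q) \<le> ?h \<beta>"
    if "Q \<in> wasserstein_ball r P0" "\<beta> \<in> dual_feasible C" for Q \<beta>
    using weak_duality[OF sym _ P0 that] r by simp
  have primal: "worst_case_value r P0 C = ereal (?h \<gamma>)"
    unfolding worst_case_value_def
  proof (rule antisym)
    show "(SUP Q\<in>wasserstein_ball r P0. ereal (\<integral>w. w \<bullet> (C *v w) \<partial>Q)) \<le> ereal (?h \<gamma>)"
      by (rule SUP_least) (simp add: weak \<gamma>(1))
    show "ereal (?h \<gamma>) \<le> (SUP Q\<in>wasserstein_ball r P0. ereal (\<integral>w. w \<bullet> (C *v w) \<partial>Q))"
      by (rule SUP_upper2[OF P(1)]) (simp add: P(2))
  qed
  have dual: "dual_value r P0 C = ereal (?h \<gamma>)"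
    unfolding dual_value_def
  proof (rule antisym)
    show "(INF \<beta>\<in>dual_feasible C. ereal (?h \<beta>)) \<le> ereal (?h \<gamma>)"
      by (rule INF_lower[OF \<gamma>(1)])
    show "ereal (?h \<gamma>) \<le> (INF \<beta>\<in>dual_feasible C. ereal (?h \<beta>))"
      by (rule INF_greatest) (use weak[OF P(1)] P(2) in simp)
  qed
  show ?thesis
    using primal dual convex_dual_objective[OF P0 sym] by simp
qed

end
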